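(* Let $P$ be a poset such that $\textup{mxl}(P)$ is a cutset of $P$. Suppose that every $C\in \Gamma(P,\textup{mxl}(P))$ has a maximum element. Let $P_{0}=\{\max C \mid C\in \Gamma(P,\textup{mxl}(P))\}$ (as a subposet of $P$) and let $i\colon P_{0}\to P$ be the inclusion map. Then: (a) there exists an order-preserving retraction $r\colon P\to P_{0}$ (so $ri=\textup{id}_{P_0}$) such that $ir\geq \textup{id}_P$; in particular, $P_{0}$ is a strong deformation retract of $P$; (b) the posets $\Gamma(P,\textup{mxl}(P))$ and $P_{0}$ are isomorphic.
   Context: $\textup{mxl}(P)$ is the set of maximal elements of $P$. For $a\in P$, $\textnormal{st}_P(a)=\{x\in P\mid x\leq a \text{ or } x\geq a\}$; for non-empty $A\subseteq P$, $\textnormal{st}_P(A)=\bigcap_{a\in A}\textnormal{st}_P(a)$. $X\subseteq P$ is a cutset if for every finite chain $\sigma$ of $P$ there is $a\in X$ with $\sigma\cup\{a\}$ a chain. The crosscut poset $\Gamma(P,X)$ is the set of connected components (w.r.t. comparability) of the non-empty subposets $\textnormal{st}_P(A)$, $A$ a non-empty subset of $X$, ordered by inclusion. Posets are topological spaces via the Alexandroff topology whose open sets are the down-sets; $f\geq g$ for maps into a poset means $f(x)\geq g(x)$ for all $x$. *)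

theory Defs
  imports "HOL-Analysis.Analysis"
begin

text \<open>
  A poset is a set \<open>P\<close> of elements of an ordered type, with the induced order.
\<close>

definition mxl :: "'a::order set \<Rightarrow> 'a set" where
  "mxl P = {x \<in> P. \<forall>y\<in>P. x \<le> y \<longrightarrow> y = x}"

definition star :: "'a::order set \<Rightarrow> 'a \<Rightarrow> 'a set" where
  "star P a = {x \<in> P. x \<le> a \<or> a \<le> x}"

text \<open>Only meaningful for non-empty \<open>A\<close>: the empty intersection is \<open>UNIV\<close>.\<close>

definition star_set :: "'a::order set \<Rightarrow> 'a set \<Rightarrow> 'a set" where
  "star_set P A = (\<Inter>a\<in>A. star P a)"

text \<open>The empty set counts as a finite chain, so a cutset is non-empty.\<close>

definition cutset :: "'a::order set \<Rightarrow> 'a set \<Rightarrow> bool" where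
  "cutset P X \<longleftrightarrow> X \<subseteq> P \<and>
     (\<forall>\<sigma>. finite \<sigma> \<and> \<sigma> \<subseteq> P \<and> Complete_Partial_Order.chain (\<le>) \<sigma> \<longrightarrow>
        (\<exists>a\<in>X. Complete_Partial_Order.chain (\<le>) (\<sigma> \<union> {a})))"

definition comparability :: "'a::order set \<Rightarrow> ('a \<times> 'a) set" where
  "comparability S = {(x, y). x \<in> S \<and> y \<in> S \<and> (x \<le> y \<or> y \<le> x)}"

text \<open>
  Comparability is reflexive and symmetric on \<open>S\<close>, so the connected components of \<open>S\<close> are
  the classes of its transitive closure.
\<close>

definition order_components :: "'a::order set \<Rightarrow> 'a set set" where
  "order_components S = S // (comparability S)\<^sup>+"

text \<open>The order on the crosscut poset is the inclusion order of the type of sets.\<close>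

definition crosscut_poset :: "'a::order set \<Rightarrow> 'a set \<Rightarrow> 'a set set" where
  "crosscut_poset P X =
     (\<Union>A\<in>{A. A \<noteq> {} \<and> A \<subseteq> X \<and> star_set P A \<noteq> {}}. order_components (star_set P A))"

definition has_maximum :: "'a::order set \<Rightarrow> bool" where
  "has_maximum C \<longleftrightarrow> (\<exists>m\<in>C. \<forall>x\<in>C. x \<le> m)"

definition maximum :: "'a::order set \<Rightarrow> 'a" where
  "maximum C = (GREATEST x. x \<in> C)"

definition order_isomorphic :: "'a::order set \<Rightarrow> 'b::order set \<Rightarrow> bool" where
  "order_isomorphic P Q \<longleftrightarrow>
     (\<exists>f. bij_betw f P Q \<and> (\<forall>x\<in>P. \<forall>y\<in>P. x \<le> y \<longleftrightarrow> f x \<le> f y))"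

definition alexandroff :: "'a::order set \<Rightarrow> 'a topology" where
  "alexandroff P = topology (\<lambda>U. U \<subseteq> P \<and> (\<forall>x\<in>U. \<forall>y\<in>P. y \<le> x \<longrightarrow> y \<in> U))"

lemma openin_alexandroff:
  "openin (alexandroff P) U \<longleftrightarrow> U \<subseteq> P \<and> (\<forall>x\<in>U. \<forall>y\<in>P. y \<le> x \<longrightarrow> y \<in> U)"
proof -
  have "istopology (\<lambda>U. U \<subseteq> P \<and> (\<forall>x\<in>U. \<forall>y\<in>P. y \<le> x \<longrightarrow> y \<in> U))"
    unfolding istopology_def by blast
  then show ?thesis
    by (simp add: alexandroff_def topology_inverse')
qed

lemma topspace_alexandroff [simp]: "topspace (alexandroff P) = P"
  unfolding topspace_def by (auto simp: openin_alexandroff)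

text \<open>The subspace topology on a subposet is its own Alexandroff topology.\<close>

lemma subtopology_alexandroff:
  assumes "Q \<subseteq> P"
  shows "subtopology (alexandroff P) Q = alexandroff Q"
proof (rule topology_eq [THEN iffD2], intro allI iffI)
  fix U assume "openin (subtopology (alexandroff P) Q) U"
  then show "openin (alexandroff Q) U"
    using assms by (auto simp: openin_subtopology openin_alexandroff)
next
  fix U assume U: "openin (alexandroff Q) U"
  let ?T = "{y \<in> P. \<exists>x\<in>U. y \<le> x}"
  have "openin (alexandroff P) ?T"
    by (auto simp: openin_alexandroff intro: order_trans)
  moreover have "U = ?T \<inter> Q"
    using U assms by (auto simp: openin_alexandroff)
  ultimately show "openin (subtopology (alexandroff P) Q) U"
    unfolding openin_subtopology by blast
qed

text \<open>Strong: the homotopy from the identity to the retraction fixes \<open>S\<close> pointwise at all times.\<close>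

definition strong_deformation_retract :: "'a topology \<Rightarrow> 'a set \<Rightarrow> bool" where
  "strong_deformation_retract X S \<longleftrightarrow> S \<subseteq> topspace X \<and>
     (\<exists>r. retraction_maps X (subtopology X S) r id \<and>
          homotopic_with (\<lambda>h. \<forall>x\<in>S. h x = x) X X id r)"

end

(*
  For a set A of maximal elements, the star of A is the set of common lower bounds of A, a
  down-set of P.  Its components are then down-sets too, so a component with maximum m is the
  principal down-set of m; this gives (b).  For (a), send x to the maximum r x of its component
  in the star of the set of all maximal elements above x.  This map dominates the identity, and
  the homotopy that stays at x for t < 1 and jumps to r x at t = 1 is continuous, since open sets
  are down-sets.
*)

theory Submission
  imports Defs
begin

text \<open>The preimage of a down-set under a monotone map is again a down-set.\<close>

lemma continuous_map_alexandroff: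
  assumes "f \<in> P \<rightarrow> Q" and "mono_on P f"
  shows "continuous_map (alexandroff P) (alexandroff Q) f"
  unfolding continuous_map_def
proof (intro conjI allI impI)
  fix U assume U: "openin (alexandroff Q) U"
  have "f y \<in> U" if "f x \<in> U" "x \<in> P" "y \<in> P" "y \<le> x" for x y
  proof -
    have "f y \<le> f x" "f y \<in> Q"
      using assms that by (auto intro: mono_onD)
    then show ?thesis
      using U that(1) unfolding openin_alexandroff by blast
  qed
  then show "openin (alexandroff P) {x \<in> topspace (alexandroff P). f x \<in> U}"
    by (auto simp: openin_alexandroff)
qed (use assms in simp)

text \<open>Every stage of the homotopy that jumps at time 1 is \<open>f\<close> or \<open>g\<close>
  itself, so it is enough to ask \<open>p\<close> of these two maps.\<close>

lemma homotopic_with_alexandroff_le: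
  fixes P :: "'a::order set" and Q :: "'b::order set"
  assumes f: "f \<in> P \<rightarrow> Q" "mono_on P f"
    and g: "g \<in> P \<rightarrow> Q" "mono_on P g"
    and le: "\<And>x. x \<in> P \<Longrightarrow> f x \<le> g x"
    and p: "p f" "p g"
  shows "homotopic_with p (alexandroff P) (alexandroff Q) f g"
proof -
  let ?I = "top_of_set {0..1::real}"
  define h where "h = (\<lambda>(t::real, x). if t = 1 then g x else f x)"
  have "continuous_map (prod_topology ?I (alexandroff P)) (alexandroff Q) h"
    unfolding continuous_map_def
  proof (intro conjI allI impI)
    show "h \<in> topspace (prod_topology ?I (alexandroff P)) \<rightarrow> topspace (alexandroff Q)"
      using f g by (auto simp: h_def)
  next
    fix U assume U: "openin (alexandroff Q) U"
    let ?F = "{x \<in> P. f x \<in> U}" and ?G = "{x \<in> P. g x \<in> U}"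
    have "openin (alexandroff P) ?F" "openin (alexandroff P) ?G"
      using openin_continuous_map_preimage [OF continuous_map_alexandroff [OF f] U]
        openin_continuous_map_preimage [OF continuous_map_alexandroff [OF g] U]
      by simp_all
    moreover have "openin ?I {0..<1}"
      by (rule openin_open [THEN iffD2]) (rule exI [of _ "{..<1}"], auto)
    moreover have "openin ?I {0..1}"
      by simp
    ultimately have "openin (prod_topology ?I (alexandroff P)) ({0..<1} \<times> ?F \<union> {0..1} \<times> ?G)"
      by (intro openin_Un) (simp_all add: openin_prod_Times_iff)
    \<comment> \<open>Since \<open>U\<close> is a down-set and \<open>f\<close> lies below
      \<open>g\<close>, \<open>?G\<close> is contained in \<open>?F\<close>. Hence the full strip
      over \<open>?G\<close> adds nothing new at times before 1, and at time 1 it is exactly what is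
      required.\<close>
    moreover have "{z \<in> topspace (prod_topology ?I (alexandroff P)). h z \<in> U}
        = {0..<1} \<times> ?F \<union> {0..1} \<times> ?G"
    proof -
      have "f x \<in> U" if "x \<in> P" "g x \<in> U" for x
        using U that le [OF that(1)] funcset_mem [OF f(1) that(1)]
        unfolding openin_alexandroff by blast
      then show ?thesis
        by (auto simp: h_def split: if_splits)
    qed
    ultimately show "openin (prod_topology ?I (alexandroff P))
        {z \<in> topspace (prod_topology ?I (alexandroff P)). h z \<in> U}"
      by simp
  qed
  moreover have "(\<lambda>x. h (t, x)) = f \<or> (\<lambda>x. h (t, x)) = g" for t
    by (cases "t = 1") (simp_all add: h_def)
  then have "p (\<lambda>x. h (t, x))" for t
    using p by metis
  ultimately show ?thesis
    unfolding homotopic_with_def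
    by (intro exI [of _ h]) (simp add: h_def)
qed

text \<open>Both \<open>id\<close> and \<open>r\<close> fix \<open>Q\<close> pointwise, so the
  predicate demanded of the homotopy holds at its two ends, and the comparison of \<open>id\<close>
  with \<open>r\<close> supplies the homotopy.\<close>

lemma strong_deformation_retract_alexandroff:
  assumes "Q \<subseteq> P" and r: "r \<in> P \<rightarrow> Q" "mono_on P r"
    and "\<forall>x\<in>Q. r x = x" and "\<forall>x\<in>P. x \<le> r x"
  shows "strong_deformation_retract (alexandroff P) Q"
proof -
  have "mono_on Q id" "mono_on P id"
    by (simp_all add: mono_on_def)
  then have "retraction_maps (alexandroff P) (subtopology (alexandroff P) Q) r id"
    using assms
    by (auto simp: retraction_maps_def subtopology_alexandroff intro!: continuous_map_alexandroff)
  moreover have "homotopic_with (\<lambda>h. \<forall>x\<in>Q. h x = x) (alexandroff P) (alexandroff P) id r"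
    using assms \<open>mono_on P id\<close> by (intro homotopic_with_alexandroff_le) auto
  ultimately show ?thesis
    using assms(1) by (auto simp: strong_deformation_retract_def)
qed

lemma equiv_comparability: "equiv S ((comparability S)\<^sup>+)"
proof (rule equivI)
  show sub: "(comparability S)\<^sup>+ \<subseteq> S \<times> S"
    by (rule trancl_subset_Sigma) (auto simp: comparability_def)
  show "refl_on S ((comparability S)\<^sup>+)"
    by (rule refl_onI) (auto simp: comparability_def)
  show "sym ((comparability S)\<^sup>+)"
    by (intro sym_trancl symI) (auto simp: comparability_def)
  show "trans ((comparability S)\<^sup>+)"
    by (rule trans_trancl)
qed

lemma order_components_subset: "C \<in> order_components S \<Longrightarrow> C \<subseteq> S"
  unfolding order_components_def by (rule in_quotient_imp_subset [OF equiv_comparability])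

text \<open>A single comparability is already a path in the transitive closure. Membership in a
  component is always shown below by such one-step paths.\<close>

lemma order_component_closed:
  assumes "C \<in> order_components S" and "x \<in> C" and "y \<in> S" and "x \<le> y \<or> y \<le> x"
  shows "y \<in> C"
proof -
  have "x \<in> S"
    using assms(1,2) order_components_subset by blast
  then have "(x, y) \<in> (comparability S)\<^sup>+"
    using assms by (auto simp: comparability_def)
  then show ?thesis
    using in_quotient_imp_closed [OF equiv_comparability] assms
    unfolding order_components_def by metis
qed

lemma obtain_order_component:
  assumes "x \<in> S"
  obtains C where "C \<in> order_components S" and "x \<in> C"
proof
  show "(comparability S)\<^sup>+ `` {x} \<in> order_components S"
    unfolding order_components_def by (rule quotientI [OF assms])
  show "x \<in> (comparability S)\<^sup>+ `` {x}"
    by (rule equiv_class_self [OF equiv_comparability assms])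
qed

text \<open>A greatest element is unique by antisymmetry, so \<open>GREATEST\<close> returns the
  witness of \<open>has_maximum\<close>.\<close>

lemma maximum_in: "has_maximum C \<Longrightarrow> maximum C \<in> C"
  and maximum_ge: "has_maximum C \<Longrightarrow> x \<in> C \<Longrightarrow> x \<le> maximum C"
  unfolding has_maximum_def maximum_def
  by (metis Greatest_equality)+

text \<open>Nothing lies strictly above a maximal \<open>a\<close>, so the alternative
  \<open>a \<le> x\<close> in the star collapses to \<open>x = a\<close>. Non-emptiness of
  \<open>A\<close> keeps the intersection inside \<open>P\<close>.\<close>

lemma star_set_mxl:
  assumes "A \<subseteq> mxl P" and "A \<noteq> {}"
  shows "star_set P A = {x \<in> P. \<forall>a\<in>A. x \<le> a}"
  using assms unfolding star_set_def star_def mxl_def by fastforce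

lemma mxl_component_eq:
  assumes C: "C \<in> crosscut_poset P (mxl P)" and max: "has_maximum C"
  shows "C = {x \<in> P. x \<le> maximum C}"
proof -
  obtain A where A: "A \<noteq> {}" "A \<subseteq> mxl P" and comp: "C \<in> order_components (star_set P A)"
    using C unfolding crosscut_poset_def by blast
  note star = star_set_mxl [OF A(2,1)]
  have "x \<in> C" if "x \<in> P" "x \<le> maximum C" for x
  proof (rule order_component_closed [OF comp maximum_in [OF max]])
    show "x \<in> star_set P A"
      using order_components_subset [OF comp] maximum_in [OF max] that
      by (auto simp: star intro: order_trans)
  qed (use that in blast)
  moreover have "C \<subseteq> P"
    using order_components_subset [OF comp] by (auto simp: star)
  ultimately show ?thesis
    using maximum_ge [OF max] by blast
qed

text \<open>The cutset condition for the chain \<open>{x}\<close> yields a maximal \<open>a\<close>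
  comparable to \<open>x\<close>; if \<open>a \<le> x\<close>, then maximality gives
  \<open>x = a\<close>.\<close>

lemma cutset_mxl_above:
  assumes "cutset P (mxl P)" and "x \<in> P"
  obtains a where "a \<in> mxl P" and "x \<le> a"
proof -
  have "Complete_Partial_Order.chain (\<le>) {x}"
    by (simp add: chain_def)
  then obtain a where a: "a \<in> mxl P" "Complete_Partial_Order.chain (\<le>) ({x} \<union> {a})"
    using assms unfolding cutset_def by (meson empty_subsetI finite.simps insert_subset)
  then have "x \<le> a"
    using assms(2) by (auto simp: chain_def mxl_def)
  with a that show ?thesis
    by blast
qed

lemma crosscut_mxl_retraction:
  assumes cut: "cutset P (mxl P)"
    and max: "\<forall>C\<in>crosscut_poset P (mxl P). has_maximum C"
  defines "Q \<equiv> {maximum C | C. C \<in> crosscut_poset P (mxl P)}"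
  obtains r where "r \<in> P \<rightarrow> Q" and "mono_on P r" and "\<forall>x\<in>Q. r x = x" and "\<forall>x\<in>P. x \<le> r x"
proof -
  \<comment> \<open>This is the largest set of maximal elements whose star contains
    \<open>x\<close>, so by \<open>star_anti\<close> its star is the smallest such star.\<close>
  define up where "up x = {a \<in> mxl P. x \<le> a}" for x
  have up: "up x \<noteq> {}" "up x \<subseteq> mxl P" if "x \<in> P" for x
    using cutset_mxl_above [OF cut that] by (auto simp: up_def)
  have in_star: "x \<in> star_set P (up x)" if "x \<in> P" for x
    using that by (simp add: star_set_mxl up) (simp add: up_def)
  have "\<exists>C. C \<in> order_components (star_set P (up x)) \<and> x \<in> C" if "x \<in> P" for x
    using obtain_order_component [OF in_star [OF that]] by blast
  then obtain K where K: "\<And>x. x \<in> P \<Longrightarrow> K x \<in> order_components (star_set P (up x))"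
    and K_self: "\<And>x. x \<in> P \<Longrightarrow> x \<in> K x"
    by metis
  have K_crosscut: "K x \<in> crosscut_poset P (mxl P)" if "x \<in> P" for x
    unfolding crosscut_poset_def
    by (rule UN_I [where a = "up x"]) (use up [OF that] in_star [OF that] K [OF that] in auto)
  then have K_max: "has_maximum (K x)" if "x \<in> P" for x
    using max that by blast
  define r where "r x = maximum (K x)" for x
  have r_in: "r x \<in> K x" and r_ge: "x \<le> r x" if "x \<in> P" for x
    using that K_max K_self by (auto simp: r_def intro: maximum_in maximum_ge)
  then have r_star: "r x \<in> star_set P (up x)" if "x \<in> P" for x
    using that K order_components_subset by blast
  have star_anti: "star_set P (up x) \<subseteq> star_set P A" if "A \<subseteq> up x" for x A
    using that by (auto simp: star_set_def)
  have "mono_on P r"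
  proof (rule mono_onI)
    fix x y assume xy: "x \<in> P" "y \<in> P" "x \<le> y"
    \<comment> \<open>Going up from \<open>x\<close> to \<open>y\<close> shrinks \<open>up\<close>
      and enlarges the star. In the star of \<open>up y\<close>, the element \<open>x\<close> is
      comparable to \<open>y\<close> and \<open>r x\<close> to \<open>x\<close>, so both lie in
      \<open>K y\<close>, whose maximum is \<open>r y\<close>.\<close>
    then have "up y \<subseteq> up x"
      by (auto simp: up_def)
    then have "x \<in> star_set P (up y)" "r x \<in> star_set P (up y)"
      using star_anti in_star r_star xy by blast+
    then have "r x \<in> K y"
      using order_component_closed [OF K [OF xy(2)]] K_self r_ge xy by metis
    then show "r x \<le> r y"
      unfolding r_def [of y] using K_max xy by (intro maximum_ge)
  qed
  moreover have "r x = x" if "x \<in> Q" for x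
  proof -
    obtain C A where C: "C \<in> crosscut_poset P (mxl P)" and x: "x = maximum C"
      and A: "A \<noteq> {}" "A \<subseteq> mxl P" and comp: "C \<in> order_components (star_set P A)"
      using \<open>x \<in> Q\<close> unfolding Q_def crosscut_poset_def by blast
    have "has_maximum C"
      using max C by blast
    then have "x \<in> C"
      unfolding x by (rule maximum_in)
    \<comment> \<open>The set \<open>A\<close> that produced \<open>C\<close> may be smaller than
      \<open>up x\<close>, so \<open>C\<close> and \<open>K x\<close> may come from different stars.
      Still, \<open>r x\<close> lies in the star of \<open>A\<close> and above \<open>x\<close>,
      hence in \<open>C\<close>, where \<open>x\<close> is the maximum.\<close>
    then have "x \<in> P" "A \<subseteq> up x"
      using order_components_subset [OF comp] A by (auto simp: star_set_mxl up_def)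
    then have "r x \<in> C"
      using order_component_closed [OF comp \<open>x \<in> C\<close>] star_anti r_star r_ge by blast
    then have "r x \<le> x"
      unfolding x using maximum_ge \<open>has_maximum C\<close> by blast
    then show ?thesis
      using r_ge \<open>x \<in> P\<close> by (simp add: order_antisym)
  qed
  moreover have "r \<in> P \<rightarrow> Q"
    using K_crosscut by (auto simp: r_def Q_def)
  ultimately show ?thesis
    using that r_ge by blast
qed

theorem theorem3p16:
  fixes P P\<^sub>0 :: "'a::order set"
  assumes "cutset P (mxl P)"
    and "\<forall>C\<in>crosscut_poset P (mxl P). has_maximum C"
    and "P\<^sub>0 = {maximum C | C. C \<in> crosscut_poset P (mxl P)}"
  shows "(\<exists>r. r \<in> P \<rightarrow> P\<^sub>0 \<and> mono_on P r \<and> (\<forall>x\<in>P\<^sub>0. r x = x) \<and> (\<forall>x\<in>P. x \<le> r x))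
       \<and> strong_deformation_retract (alexandroff P) P\<^sub>0
       \<and> order_isomorphic (crosscut_poset P (mxl P)) P\<^sub>0"
proof -
  let ?\<Gamma> = "crosscut_poset P (mxl P)"
  obtain r where r: "r \<in> P \<rightarrow> P\<^sub>0" "mono_on P r" "\<forall>x\<in>P\<^sub>0. r x = x" "\<forall>x\<in>P. x \<le> r x"
    using crosscut_mxl_retraction [OF assms(1,2)] unfolding assms(3) by blast
  have down: "C = {x \<in> P. x \<le> maximum C}" if "C \<in> ?\<Gamma>" for C
    using that assms(2) by (intro mxl_component_eq) auto
  have max_in: "maximum C \<in> C" if "C \<in> ?\<Gamma>" for C
    using that assms(2) by (intro maximum_in) auto
  have "P\<^sub>0 \<subseteq> P"
    using down max_in unfolding assms(3) by blast
  then have "strong_deformation_retract (alexandroff P) P\<^sub>0"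
    using r by (intro strong_deformation_retract_alexandroff)
  \<comment> \<open>Each component is the principal down-set of its maximum, so inclusion of
    components is the order of their maxima. This also makes \<open>maximum\<close> injective, by
    antisymmetry.\<close>
  moreover have "C \<subseteq> D \<longleftrightarrow> maximum C \<le> maximum D" if "C \<in> ?\<Gamma>" "D \<in> ?\<Gamma>" for C D
    using down [OF that(1)] down [OF that(2)] max_in [OF that(1)]
    by (blast intro: order_trans)
  then have "order_isomorphic ?\<Gamma> P\<^sub>0"
    unfolding order_isomorphic_def assms(3)
    by (intro exI [of _ maximum]) (auto simp: bij_betw_def inj_on_def set_eq_subset)
  ultimately show ?thesis
    using r by blast
qed

end
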